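(* Let $(X,d)$ and $(Y, \varrho)$ be metric spaces. Consider a $c > 0$, non-empty sets $U \subset X$ and $V \subset Y$, a function $\gamma: X \to(0, \infty]$ defined and not identically zero on $U$, and a set-valued mapping $G:X \rightrightarrows Y$. Then the following three statements are equivalent: $G$ has property $(\mathcal{O})$ on $U \times V$ for $c$ and $\gamma$; $G$ has property $(\mathcal{R})$ on $U \times V$ for $1/c$ and $\gamma$; $G$ has property $(\mathcal{L}^{-1})$ on $U \times V$ for $1/c$ and $\gamma$.
   Context: A set-valued mapping $G:X\rightrightarrows Y$ assigns to each $x\in X$ a (possibly empty) set $G(x)\subset Y$; $G(M):=\bigcup_{x\in M}G(x)$ for $M\subset X$; $G^{-1}(y):=\{x\in X: y\in G(x)\}$ and $G^{-1}(M):=\bigcup_{y\in M}G^{-1}(y)$ for $M\subset Y$. $B_X(x,r)$ denotes the open ball of radius $r$ around $x$ (similarly in $Y$), $\overline{C}$ the closure of $C$, and $\mathrm{dist}(x,C):=\inf\{d(x,u):u\in C\}$, with $\inf\emptyset=\infty$. The function $\gamma$ need only be defined on $U$. Let $\mu>0$. The mapping $G$ has for $\mu$ and $\gamma$ on $U\times V$ property $(\mathcal{O})$ provided that $B_Y(y,\mu t) \cap V \subset \overline{G(B_X(x,t))}$ for each $x \in U$, each $y \in G(x)$, and each $t \in (0,\gamma(x))$; $(\mathcal{R})$ provided that $\lim_{\varepsilon\downarrow 0} \mathrm{dist}\big(x,G^{-1}(B_Y(y,\varepsilon))\big)\leq \mu\, \mathrm{dist}(y, G(x))$ for each $(x,y)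 \in U \times V$ such that $\mu\, \mathrm{dist}(y, G(x)) < \gamma(x)$; $(\mathcal{L}^{-1})$ provided that $\lim_{\varepsilon\downarrow 0} \mathrm{dist}\big(x,G^{-1}(B_Y(y',\varepsilon))\big)\leq \mu\, \varrho(y,y')$ for each $y\in Y$, each $y' \in V$, and each $x \in G^{-1}(y)\cap U$ such that $\mu\, \varrho(y,y') < \gamma(x)$. *)

theory Defs
  imports "HOL-Analysis.Analysis"
begin

definition sv_image :: "('a \<Rightarrow> 'b set) \<Rightarrow> 'a set \<Rightarrow> 'b set" where
  "sv_image G M = (\<Union>x\<in>M. G x)"

definition sv_inverse :: "('a \<Rightarrow> 'b set) \<Rightarrow> 'b \<Rightarrow> 'a set" where
  "sv_inverse G y = {x. y \<in> G x}"

text \<open>The library's \<^const>\<open>infdist\<close> is real-valued and equals \<open>0\<close> on the empty set; here the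
  distance to the empty set is \<open>\<infinity>\<close>, the infimum of the empty set in \<^typ>\<open>ennreal\<close>.\<close>

definition edist_to :: "'a::metric_space \<Rightarrow> 'a set \<Rightarrow> ennreal" where
  "edist_to x C = (INF u\<in>C. ennreal (dist x u))"

definition inv_ball_dist ::
  "('a::metric_space \<Rightarrow> 'b::metric_space set) \<Rightarrow> 'a \<Rightarrow> 'b \<Rightarrow> real \<Rightarrow> ennreal" where
  "inv_ball_dist G x y \<epsilon> = edist_to x (sv_image (sv_inverse G) (ball y \<epsilon>))"

text \<open>The limits in the properties (R) and (L\<open>\<inverse>\<close>) below are written with \<^const>\<open>Lim\<close>. They always
  exist in \<open>[0, \<infinity>]\<close>, because the function is antitone.\<close>

lemma inv_ball_dist_antimono: "antimono (inv_ball_dist G x y)"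
  unfolding inv_ball_dist_def edist_to_def sv_image_def
  by (intro antimonoI INF_superset_mono UN_mono subset_ball) auto

lemma inv_ball_dist_tendsto_Lim:
  "(inv_ball_dist G x y \<longlongrightarrow> Lim (at_right 0) (inv_ball_dist G x y)) (at_right 0)"
proof -
  let ?f = "inv_ball_dist G x y"
  have "(?f \<longlongrightarrow> (SUP e\<in>{0<..}. ?f e)) (at_right 0)"
  proof (rule order_tendstoI)
    fix a assume "a < (SUP e\<in>{0<..}. ?f e)"
    then obtain e where e: "e > 0" "a < ?f e"
      by (auto simp: less_SUP_iff)
    have "a < ?f e'" if "e' < e" for e'
      using e(2) antimonoD[OF inv_ball_dist_antimono[of G x y], of e' e] that by auto
    then show "\<forall>\<^sub>F e' in at_right 0. a < ?f e'"
      using e(1) by (auto simp: eventually_at_right_field)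
  next
    fix a assume "(SUP e\<in>{0<..}. ?f e) < a"
    then have "?f e < a" if "e > 0" for e
      using that by (meson SUP_upper greaterThan_iff le_less_trans)
    then show "\<forall>\<^sub>F e in at_right 0. ?f e < a"
      by (auto simp: eventually_at_right_field intro: exI[of _ 1])
  qed
  then show ?thesis
    by (metis tendsto_Lim trivial_limit_at_right_real)
qed

text \<open>The constant \<open>\<mu>\<close> is meant to be positive; \<^const>\<open>ennreal\<close> sends negative reals to \<open>0\<close>. As
  \<open>ennreal \<mu> * \<infinity> = \<infinity>\<close> for positive \<open>\<mu>\<close>, the condition in (R) excludes empty \<open>G x\<close>.\<close>

definition property_O ::
  "real \<Rightarrow> ('a::metric_space \<Rightarrow> ennreal) \<Rightarrow> 'a set \<Rightarrow> 'b::metric_space set \<Rightarrow> ('a \<Rightarrow> 'b set) \<Rightarrow> bool"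
  where
  "property_O \<mu> \<gamma> U V G \<longleftrightarrow>
     (\<forall>x\<in>U. \<forall>y\<in>G x. \<forall>t::real. 0 < t \<and> ennreal t < \<gamma> x \<longrightarrow>
        ball y (\<mu> * t) \<inter> V \<subseteq> closure (sv_image G (ball x t)))"

definition property_R ::
  "real \<Rightarrow> ('a::metric_space \<Rightarrow> ennreal) \<Rightarrow> 'a set \<Rightarrow> 'b::metric_space set \<Rightarrow> ('a \<Rightarrow> 'b set) \<Rightarrow> bool"
  where
  "property_R \<mu> \<gamma> U V G \<longleftrightarrow>
     (\<forall>(x, y)\<in>U \<times> V. ennreal \<mu> * edist_to y (G x) < \<gamma> x \<longrightarrow>
        Lim (at_right 0) (inv_ball_dist G x y) \<le> ennreal \<mu> * edist_to y (G x))"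

definition property_Linv ::
  "real \<Rightarrow> ('a::metric_space \<Rightarrow> ennreal) \<Rightarrow> 'a set \<Rightarrow> 'b::metric_space set \<Rightarrow> ('a \<Rightarrow> 'b set) \<Rightarrow> bool"
  where
  "property_Linv \<mu> \<gamma> U V G \<longleftrightarrow>
     (\<forall>y. \<forall>y'\<in>V. \<forall>x\<in>sv_inverse G y \<inter> U. ennreal (\<mu> * dist y y') < \<gamma> x \<longrightarrow>
        Lim (at_right 0) (inv_ball_dist G x y') \<le> ennreal (\<mu> * dist y y'))"

end

theory Submission
  imports Defs
begin

text \<open>The limit in (R) and (L\<open>\<inverse>\<close>) at \<open>(x, y)\<close> is at most \<open>a\<close> iff \<open>y\<close> lies in the closure of
  \<open>G(B(x, t))\<close> for every \<open>t > a\<close>. This turns both properties into statements of the same shape as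
  (O): the infimum in (R) is approximated by a point of \<open>G x\<close>, which (O) then covers.\<close>

lemma edist_to_less_iff: "edist_to x C < ennreal t \<longleftrightarrow> (\<exists>u\<in>C. dist x u < t)"
  unfolding edist_to_def by (simp add: INF_less_iff ennreal_less_iff)

lemma edist_to_le: "u \<in> C \<Longrightarrow> edist_to x C \<le> ennreal (dist x u)"
  unfolding edist_to_def by (rule INF_lower)

text \<open>Both sides are witnessed by a pair \<open>u\<close>, \<open>v\<close> with
  \<open>v\<close> in \<open>G u\<close>, \<open>u\<close> within \<open>t\<close> of
  \<open>x\<close> and \<open>v\<close> within \<open>e\<close> of \<open>y\<close>; only the order
  of choosing them differs.\<close>

lemma inv_ball_dist_less_iff:
  "inv_ball_dist G x y e < ennreal t \<longleftrightarrow> (\<exists>v\<in>sv_image G (ball x t). dist v y < e)"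
  unfolding inv_ball_dist_def edist_to_less_iff sv_image_def sv_inverse_def
  by (simp add: Bex_def dist_commute) blast

lemma closure_sv_image_ball_iff:
  "y \<in> closure (sv_image G (ball x t)) \<longleftrightarrow> (\<forall>e>0. inv_ball_dist G x y e < ennreal t)"
  unfolding inv_ball_dist_less_iff closure_approachable ..

text \<open>By antitonicity the right-hand limit at \<open>0\<close> is the supremum over positive
  radii, so bounding the limit amounts to bounding every value.\<close>

lemma Lim_inv_ball_dist_le_iff:
  "Lim (at_right 0) (inv_ball_dist G x y) \<le> a \<longleftrightarrow> (\<forall>e>0. inv_ball_dist G x y e \<le> a)"
proof
  assume le: "Lim (at_right 0) (inv_ball_dist G x y) \<le> a"
  show "\<forall>e>0. inv_ball_dist G x y e \<le> a"
  proof (intro allI impI)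
    fix e :: real assume "e > 0"
    \<comment> \<open>Shrinking the radius below \<open>e\<close> can only increase the
      distance.\<close>
    then have "\<forall>\<^sub>F e' in at_right 0. inv_ball_dist G x y e \<le> inv_ball_dist G x y e'"
      unfolding eventually_at_right_field
      by (intro exI[of _ e]) (auto intro: antimonoD[OF inv_ball_dist_antimono])
    then have "inv_ball_dist G x y e \<le> Lim (at_right 0) (inv_ball_dist G x y)"
      using tendsto_lowerbound[OF inv_ball_dist_tendsto_Lim] by simp
    then show "inv_ball_dist G x y e \<le> a" using le by simp
  qed
next
  assume "\<forall>e>0. inv_ball_dist G x y e \<le> a"
  then have "\<forall>\<^sub>F e in at_right 0. inv_ball_dist G x y e \<le> a"
    by (auto simp: eventually_at_right_field intro: exI[of _ 1])
  then show "Lim (at_right 0) (inv_ball_dist G x y) \<le> a"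
    using tendsto_upperbound[OF inv_ball_dist_tendsto_Lim] by simp
qed

text \<open>An intermediate element is finite because it lies below \<open>b\<close> and positive
  because it lies above \<open>a\<close>.\<close>

lemma ennreal_dense_real:
  fixes a b :: ennreal
  assumes "a < b"
  obtains s :: real where "0 < s" "a < ennreal s" "ennreal s < b"
proof -
  obtain z where z: "a < z" "z < b" using dense[OF assms] by blast
  then obtain s where s: "0 \<le> s" "z = ennreal s" by (cases z) auto
  then have "0 < s" using z by (cases "s = 0") auto
  then show thesis using z unfolding s(2) by (rule that)
qed

text \<open>The infimum \<open>edist_to y (G x)\<close> need not be attained, so (O) is applied at a
  radius \<open>s\<close> strictly above \<open>a\<close>, where some point of \<open>G x\<close>
  lies within \<open>c * s\<close> of \<open>y\<close>.\<close>

lemma property_O_imp_R: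
  assumes "c > 0" and O: "property_O c \<gamma> U V G"
  shows "property_R (1 / c) \<gamma> U V G"
  unfolding property_R_def
proof (safe)
  fix x y assume xy: "x \<in> U" "y \<in> V"
  define a where "a = ennreal (1 / c) * edist_to y (G x)"
  assume "ennreal (1 / c) * edist_to y (G x) < \<gamma> x"
  then have a: "a < \<gamma> x" by (simp add: a_def)
  have "inv_ball_dist G x y e \<le> a" if "e > 0" for e
  proof (rule ccontr)
    assume "\<not> inv_ball_dist G x y e \<le> a"
    \<comment> \<open>The minimum gives \<open>s\<close> two roles: below \<open>\<gamma> x\<close>
      it is admissible in (O), and below \<open>inv_ball_dist G x y e\<close> it contradicts the
      closure membership that (O) yields.\<close>
    then have "a < min (inv_ball_dist G x y e) (\<gamma> x)" using a by simp
    then obtain s where s: "0 < s" "a < ennreal s" "ennreal s < inv_ball_dist G x y e"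
      "ennreal s < \<gamma> x"
      by (rule ennreal_dense_real) auto
    have "edist_to y (G x) = ennreal c * a"
      using \<open>c > 0\<close> by (simp add: a_def mult.assoc[symmetric] ennreal_mult[symmetric])
    also have "\<dots> < ennreal c * ennreal s"
      using s(2) \<open>c > 0\<close> by (intro ennreal_mult_strict_left_mono) auto
    finally have "edist_to y (G x) < ennreal (c * s)"
      using s(1) \<open>c > 0\<close> by (simp add: ennreal_mult)
    then obtain v where "v \<in> G x" "dist y v < c * s"
      by (auto simp: edist_to_less_iff)
    then have "v \<in> G x" "y \<in> ball v (c * s) \<inter> V"
      using xy by (auto simp: dist_commute)
    then have "y \<in> closure (sv_image G (ball x s))"
      using O xy s(1,4) unfolding property_O_def by blast
    then show False
      using s(3) \<open>e > 0\<close> unfolding closure_sv_image_ball_iff by (meson less_asym)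
  qed
  then show "Lim (at_right 0) (inv_ball_dist G x y) \<le> ennreal (1 / c) * edist_to y (G x)"
    by (simp add: Lim_inv_ball_dist_le_iff a_def)
qed

text \<open>Since \<open>y\<close> belongs to \<open>G x\<close>, the distance from
  \<open>y'\<close> to \<open>G x\<close> is at most \<open>dist y y'\<close>; hence the condition
  in (R) is weaker and its bound sharper.\<close>

lemma property_R_imp_Linv:
  assumes "\<mu> \<ge> 0" and R: "property_R \<mu> \<gamma> U V G"
  shows "property_Linv \<mu> \<gamma> U V G"
  unfolding property_Linv_def
proof (intro allI ballI impI)
  fix y y' x
  assume y': "y' \<in> V" and x: "x \<in> sv_inverse G y \<inter> U" and less: "ennreal (\<mu> * dist y y') < \<gamma> x"
  have le: "ennreal \<mu> * edist_to y' (G x) \<le> ennreal (\<mu> * dist y y')"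
    using x edist_to_le[of y "G x" y'] \<open>\<mu> \<ge> 0\<close>
    by (auto simp: sv_inverse_def ennreal_mult dist_commute intro: mult_left_mono)
  then have "Lim (at_right 0) (inv_ball_dist G x y') \<le> ennreal \<mu> * edist_to y' (G x)"
    using R x y' less unfolding property_R_def by auto
  then show "Lim (at_right 0) (inv_ball_dist G x y') \<le> ennreal (\<mu> * dist y y')"
    using le by (rule order_trans)
qed

lemma property_Linv_imp_O:
  assumes "c > 0" and L: "property_Linv (1 / c) \<gamma> U V G"
  shows "property_O c \<gamma> U V G"
  unfolding property_O_def
proof (intro ballI allI impI subsetI)
  fix x y t y'
  assume x: "x \<in> U" "y \<in> G x" and t: "0 < t \<and> ennreal t < \<gamma> x"
    and y': "y' \<in> ball y (c * t) \<inter> V"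
  \<comment> \<open>The ball is open, so this is strict; the slack turns the non-strict bound on the
    limit into the strict inequality that characterizes the closure.\<close>
  have less: "ennreal (1 / c * dist y y') < ennreal t"
    using y' \<open>c > 0\<close> t by (intro ennreal_lessI) (auto simp: field_simps)
  then have "ennreal (1 / c * dist y y') < \<gamma> x"
    using t by (meson less_trans)
  then have "Lim (at_right 0) (inv_ball_dist G x y') \<le> ennreal (1 / c * dist y y')"
    using L x y' unfolding property_Linv_def sv_inverse_def by blast
  then show "y' \<in> closure (sv_image G (ball x t))"
    using less unfolding Lim_inv_ball_dist_le_iff closure_sv_image_ball_iff
    by (meson le_less_trans)
qed

theorem proposition3p2:
  fixes c :: real
    and U :: "'a::metric_space set"
    and V :: "'b::metric_space set"
    and \<gamma> :: "'a \<Rightarrow> ennreal"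
    and G :: "'a \<Rightarrow> 'b set"
  assumes "c > 0"
    and "U \<noteq> {}"
    and "V \<noteq> {}"
    and "\<forall>x\<in>U. 0 < \<gamma> x"
    and "\<exists>x\<in>U. \<gamma> x \<noteq> 0"
  shows "(property_O c \<gamma> U V G \<longleftrightarrow> property_R (1 / c) \<gamma> U V G) \<and>
         (property_R (1 / c) \<gamma> U V G \<longleftrightarrow> property_Linv (1 / c) \<gamma> U V G)"
proof -
  have "1 / c \<ge> 0" using \<open>c > 0\<close> by simp
  then show ?thesis
    using property_O_imp_R[OF \<open>c > 0\<close>, of \<gamma> U V G] property_R_imp_Linv[of "1 / c" \<gamma> U V G]
      property_Linv_imp_O[OF \<open>c > 0\<close>, of \<gamma> U V G]
    by blast
qed

end
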